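(* Let $n\ge 1$. (i) For any continuous ellipsoid cover $\Theta$ of $\mathbb{R}^n$, the induced quasi-distance $$\rho_\Theta(x,y):=\inf_{\theta\in\Theta}\{|\theta|: x,y\in\theta\},\qquad x,y\in\mathbb{R}^n,$$ is quasi-convex and $1$-Ahlfors-regular. (ii) Conversely, let $\rho$ be a quasi-distance on $\mathbb{R}^n$ which is quasi-convex and $1$-Ahlfors-regular, and let $\Xi=\Xi_\rho=\{\xi_x^r: x\in\mathbb{R}^n, r>0\}$ be a family of ellipsoids corresponding to $\rho$, i.e. for some $Q\ge1$, each $\xi_x^r$ is an ellipsoid with center $x$ and $\xi_x^r\subseteq B_\rho(x,r)\subseteq Q\cdot\xi_x^r$ for all $x\in\mathbb{R}^n$, $r>0$. Then $\Xi$ is a continuous ellipsoid cover of $\mathbb{R}^n$ (when indexed by scale via $\theta_{x,t}:=\xi_x^{r}$ with $r=2^{-t}$, $t\in\mathbb{R}$). Moreover, its induced quasi-distance $$\rho_\Xi(x,y):=\inf_{\xi\in\Xi}\{|\xi|: x,y\in\xi\},\qquad x,y\in\mathbb{R}^n,$$ is equivalent to $\rho$.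
   Context: $|E|$ denotes Lebesgue measure of $E\subseteq\mathbb{R}^n$, and $\mathbb{B}^n$ is the closed Euclidean unit ball. An ellipsoid is a set $\xi=M(\mathbb{B}^n)+c$ with $M$ a nonsingular real $n\times n$ matrix and $c\in\mathbb{R}^n$ its center; for $\lambda>0$, $\lambda\cdot\xi:=\lambda M(\mathbb{B}^n)+c$. Continuous ellipsoid cover: a family $\Theta=\{\theta_{x,t}: x\in\mathbb{R}^n, t\in\mathbb{R}\}$ for which there are positive constants $a_1,\dots,a_6$ such that (i) for all $x\in\mathbb{R}^n,t\in\mathbb{R}$, $\theta_{x,t}=M_{x,t}(\mathbb{B}^n)+x$ is an ellipsoid with $M_{x,t}$ a nonsingular real matrix and $a_12^{-t}\le|\theta_{x,t}|\le a_22^{-t}$; (ii) (shape condition) for all $x,y\in\mathbb{R}^n$, $t\in\mathbb{R}$, $s\ge0$, if $\theta_{x,t}\cap\theta_{y,t+s}\neq\emptyset$, then $$a_32^{-a_4s}\le 1/\|(M_{y,t+s})^{-1}M_{x,t}\|\le\|(M_{x,t})^{-1}M_{y,t+s}\|\le a_52^{-a_6s},$$ where $\|A\|=\max_{|x|=1}|Ax|$. No measurability or continuity in $(x,t)$ is assumed. A quasi-distance on $\mathbb{R}^n$ is a map $\rho:\mathbb{R}^n\times\mathbb{R}^n\to[0,\infty)$ for which there is $\kappa\ge1$ such that for all $x,y,z$: $\rho(x,y)=0\Leftrightarrow x=y$; $\rho(x,y)=\rho(y,x)$; $\rho(x,z)\le\kappa(\rho(x,y)+\rho(y,z))$. Its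 balls are $B_\rho(x,r)=\{y\in\mathbb{R}^n:\rho(x,y)<r\}$. $\rho$ is quasi-convex if there is $Q\ge1$ such that for all $x\in\mathbb{R}^n$, $r>0$ there is an ellipsoid $\xi_x^r$ with center $x$ and $\xi_x^r\subseteq B_\rho(x,r)\subseteq Q\cdot\xi_x^r$. $\rho$ is $1$-Ahlfors-regular if there is $c_1\ge1$ with $\frac1{c_1}r\le|B_\rho(x,r)|\le c_1r$ for all $x\in\mathbb{R}^n$, $r>0$. Two quasi-distances $\rho,\rho'$ are equivalent if there is $C\ge1$ with $C^{-1}\rho(x,y)\le\rho'(x,y)\le C\rho(x,y)$ for all $x,y$. *)

theory Defs
  imports "HOL-Analysis.Analysis"
begin

text \<open>The ellipsoid \<open>M(B) + c\<close>, \<open>B\<close> the closed unit ball; it is only used for invertible \<open>M\<close>.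
  The dilation \<open>l \<cdot> \<xi>\<close> of \<open>\<xi> = ellipsoid M c\<close> is \<open>ellipsoid (l *\<^sub>R M) c\<close>.\<close>

definition ellipsoid :: "real^'n^'n \<Rightarrow> real^'n \<Rightarrow> (real^'n) set" where
  "ellipsoid M c = (\<lambda>v. M *v v + c) ` cball 0 1"

definition mat_norm :: "real^'n^'n \<Rightarrow> real" where
  "mat_norm A = onorm ((*v) A)"

text \<open>The matrices \<open>M x t\<close> are determined by the sets \<open>\<theta> x t\<close> only up to an orthogonal factor on the
  right, which does not change the norms in the shape condition.\<close>

definition continuous_ellipsoid_cover :: "(real^'n \<Rightarrow> real \<Rightarrow> (real^'n) set) \<Rightarrow> bool" where
  "continuous_ellipsoid_cover \<theta> \<longleftrightarrow>
    (\<exists>M a1 a2 a3 a4 a5 a6.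
       a1 > 0 \<and> a2 > 0 \<and> a3 > 0 \<and> a4 > 0 \<and> a5 > 0 \<and> a6 > 0 \<and>
       (\<forall>x t. invertible (M x t) \<and> \<theta> x t = ellipsoid (M x t) x \<and>
          a1 * 2 powr (- t) \<le> measure lebesgue (\<theta> x t) \<and>
          measure lebesgue (\<theta> x t) \<le> a2 * 2 powr (- t)) \<and>
       (\<forall>x y t s. s \<ge> 0 \<longrightarrow> \<theta> x t \<inter> \<theta> y (t + s) \<noteq> {} \<longrightarrow>
          a3 * 2 powr (- a4 * s) \<le> 1 / mat_norm (matrix_inv (M y (t + s)) ** M x t) \<and>
          1 / mat_norm (matrix_inv (M y (t + s)) ** M x t)
            \<le> mat_norm (matrix_inv (M x t) ** M y (t + s)) \<and>
          mat_norm (matrix_inv (M x t) ** M y (t + s)) \<le> a5 * 2 powr (- a6 * s)))"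

definition quasi_distance :: "('a \<Rightarrow> 'a \<Rightarrow> real) \<Rightarrow> bool" where
  "quasi_distance \<rho> \<longleftrightarrow>
    (\<forall>x y. \<rho> x y \<ge> 0) \<and>
    (\<exists>\<kappa>\<ge>1. \<forall>x y z.
       (\<rho> x y = 0 \<longleftrightarrow> x = y) \<and> \<rho> x y = \<rho> y x \<and> \<rho> x z \<le> \<kappa> * (\<rho> x y + \<rho> y z))"

definition qball :: "('a \<Rightarrow> 'a \<Rightarrow> real) \<Rightarrow> 'a \<Rightarrow> real \<Rightarrow> 'a set" where
  "qball \<rho> x r = {y. \<rho> x y < r}"

definition quasi_convex :: "(real^'n \<Rightarrow> real^'n \<Rightarrow> real) \<Rightarrow> bool" where
  "quasi_convex \<rho> \<longleftrightarrow>
    (\<exists>Q\<ge>1. \<forall>x. \<forall>r>0. \<exists>M. invertible M \<and>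
       ellipsoid M x \<subseteq> qball \<rho> x r \<and> qball \<rho> x r \<subseteq> ellipsoid (Q *\<^sub>R M) x)"

definition corresponding_ellipsoids ::
    "(real^'n \<Rightarrow> real^'n \<Rightarrow> real) \<Rightarrow> (real^'n \<Rightarrow> real \<Rightarrow> (real^'n) set) \<Rightarrow> bool" where
  "corresponding_ellipsoids \<rho> \<xi> \<longleftrightarrow>
    (\<exists>Q\<ge>1. \<forall>x. \<forall>r>0. \<exists>M. invertible M \<and> \<xi> x r = ellipsoid M x \<and>
       \<xi> x r \<subseteq> qball \<rho> x r \<and> qball \<rho> x r \<subseteq> ellipsoid (Q *\<^sub>R M) x)"

text \<open>Balls of a quasi-distance need not be measurable in general, so their measurability is part
  of the regularity condition.\<close>

definition ahlfors_regular_1 :: "(real^'n \<Rightarrow> real^'n \<Rightarrow> real) \<Rightarrow> bool" where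
  "ahlfors_regular_1 \<rho> \<longleftrightarrow>
    (\<exists>c\<ge>1. \<forall>x. \<forall>r>0. qball \<rho> x r \<in> lmeasurable \<and>
       1 / c * r \<le> measure lebesgue (qball \<rho> x r) \<and> measure lebesgue (qball \<rho> x r) \<le> c * r)"

definition equivalent_qdist :: "('a \<Rightarrow> 'a \<Rightarrow> real) \<Rightarrow> ('a \<Rightarrow> 'a \<Rightarrow> real) \<Rightarrow> bool" where
  "equivalent_qdist \<rho> \<rho>' \<longleftrightarrow>
    (\<exists>C\<ge>1. \<forall>x y. inverse C * \<rho> x y \<le> \<rho>' x y \<and> \<rho>' x y \<le> C * \<rho> x y)"

definition induced_qdist :: "(real^'n) set set \<Rightarrow> real^'n \<Rightarrow> real^'n \<Rightarrow> real" where
  "induced_qdist \<Theta> x y = Inf {measure lebesgue E |E. E \<in> \<Theta> \<and> x \<in> E \<and> y \<in> E}"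

end

theory Submission
  imports Defs
begin

text \<open>Everything is expressed through the norms \<open>enorm M\<close> whose unit balls are the centred
  ellipsoids: the shape condition compares these norms for intersecting ellipsoids.

  For a cover, the shape condition lets an ellipsoid engulf every intersecting ellipsoid of finer
  scale after a bounded change of its own scale; this gives the quasi-triangle inequality, and it
  squeezes each ball of the induced quasi-distance between two dilations of one ellipsoid. Such a
  ball is a union of ellipsoids containing its centre, so contracting it towards the centre moves
  it into its interior; hence it is measurable.

  Conversely, intersecting balls of a quasi-convex Ahlfors-regular quasi-distance engulf each
  other, which bounds the norm at the larger scale by the norm at the smaller scale. Comparing
  volumes reverses this estimate with a factor proportional to the ratio of the radii. The
  exponential decay of the norms comes from the fact that a ball contains points near its boundary
  whose own balls stick out by a definite proportion in the radial direction.\<close>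

subsection \<open>Ellipsoids as unit balls of norms\<close>

definition enorm :: "real^'n^'n \<Rightarrow> real^'n \<Rightarrow> real" where
  "enorm A v = norm (matrix_inv A *v v)"

lemma matrix_inv_works:
  assumes "invertible A"
  shows "A ** matrix_inv A = mat 1" "matrix_inv A ** A = mat 1"
proof -
  have "\<exists>A'. A ** A' = mat 1 \<and> A' ** A = mat 1"
    using assms unfolding invertible_def .
  then have "A ** matrix_inv A = mat 1 \<and> matrix_inv A ** A = mat 1"
    unfolding matrix_inv_def by (rule someI_ex)
  then show "A ** matrix_inv A = mat 1" "matrix_inv A ** A = mat 1" by auto
qed

lemma mult_matrix_inv_cancel:
  assumes "invertible A"
  shows "A *v (matrix_inv A *v v) = v" "matrix_inv A *v (A *v v) = v"
  using matrix_inv_works[OF assms] by (simp_all add: matrix_vector_mul_assoc)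

lemma enorm_nonneg [simp]: "0 \<le> enorm A v"
  by (simp add: enorm_def)

lemma enorm_zero [simp]: "enorm A 0 = 0"
  by (simp add: enorm_def)

lemma enorm_triangle: "enorm A (u + v) \<le> enorm A u + enorm A v"
  by (simp add: enorm_def matrix_vector_right_distrib norm_triangle_ineq)

lemma enorm_triangle_diff: "enorm A (u - w) \<le> enorm A (u - v) + enorm A (v - w)"
  using enorm_triangle[of A "u - v" "v - w"] by simp

lemma enorm_scaleR [simp]: "enorm A (c *\<^sub>R v) = \<bar>c\<bar> * enorm A v"
  by (simp add: enorm_def matrix_vector_mult_scaleR)

lemma enorm_minus_commute: "enorm A (u - v) = enorm A (v - u)"
  by (simp add: enorm_def matrix_vector_mult_diff_distrib norm_minus_commute)

lemma enorm_eq_0_iff: "invertible A \<Longrightarrow> enorm A v = 0 \<longleftrightarrow> v = 0"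
  by (metis enorm_def enorm_zero matrix_vector_mult_0_right mult_matrix_inv_cancel(1) norm_eq_zero)

lemma enorm_mult: "invertible A \<Longrightarrow> enorm A (A *v v) = norm v"
  by (simp add: enorm_def mult_matrix_inv_cancel)

lemma continuous_on_enorm: "continuous_on S (\<lambda>v. enorm A (v - z))"
  unfolding enorm_def
  by (intro continuous_intros bounded_linear.continuous_on[OF matrix_vector_mul_bounded_linear])

lemma mem_ellipsoid_scaleR:
  assumes "invertible M" "0 < Q"
  shows "y \<in> ellipsoid (Q *\<^sub>R M) x \<longleftrightarrow> enorm M (y - x) \<le> Q"
proof
  assume "y \<in> ellipsoid (Q *\<^sub>R M) x"
  then obtain v where "norm v \<le> 1" "y = Q *\<^sub>R M *v v + x"
    by (auto simp: ellipsoid_def)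
  then show "enorm M (y - x) \<le> Q"
    using assms by (simp add: enorm_mult flip: scaleR_matrix_vector_assoc)
next
  assume "enorm M (y - x) \<le> Q"
  then have "norm ((1/Q) *\<^sub>R (matrix_inv M *v (y - x))) \<le> 1"
    using assms by (simp add: enorm_def)
  moreover have "y = Q *\<^sub>R M *v ((1/Q) *\<^sub>R (matrix_inv M *v (y - x))) + x"
    using assms
    by (simp add: matrix_vector_mult_scaleR mult_matrix_inv_cancel flip: scaleR_matrix_vector_assoc)
  ultimately show "y \<in> ellipsoid (Q *\<^sub>R M) x"
    unfolding ellipsoid_def by (metis (no_types, lifting) dist_0_norm image_eqI mem_cball)
qed

lemma mem_ellipsoid:
  assumes "invertible M"
  shows "y \<in> ellipsoid M x \<longleftrightarrow> enorm M (y - x) \<le> 1"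
  using mem_ellipsoid_scaleR[OF assms, of 1 y x] by simp

text \<open>Every \<open>v\<close> equals \<open>B *v w\<close> with
  \<open>norm w = enorm B v\<close>, so an operator norm bound and a pointwise comparison of the two
  norms are the same statement. This is how the shape condition is read throughout.\<close>

lemma mat_norm_le_iff:
  assumes "invertible A" "invertible B"
  shows "mat_norm (matrix_inv A ** B) \<le> c \<longleftrightarrow> (\<forall>v. enorm A v \<le> c * enorm B v)"
proof
  assume le: "mat_norm (matrix_inv A ** B) \<le> c"
  show "\<forall>v. enorm A v \<le> c * enorm B v"
  proof
    fix v
    have "enorm A v = norm ((matrix_inv A ** B) *v (matrix_inv B *v v))"
      by (simp add: enorm_def mult_matrix_inv_cancel assms flip: matrix_vector_mul_assoc)
    also have "\<dots> \<le> mat_norm (matrix_inv A ** B) * enorm B v"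
      unfolding mat_norm_def enorm_def by (intro onorm) auto
    finally show "enorm A v \<le> c * enorm B v"
      using mult_right_mono[OF le enorm_nonneg[of B v]] by linarith
  qed
next
  assume *: "\<forall>v. enorm A v \<le> c * enorm B v"
  show "mat_norm (matrix_inv A ** B) \<le> c"
    unfolding mat_norm_def
  proof (rule onorm_le)
    fix w
    show "norm ((matrix_inv A ** B) *v w) \<le> c * norm w"
      using *[rule_format, of "B *v w"] assms
      by (simp add: enorm_mult) (simp add: enorm_def matrix_vector_mul_assoc)
  qed
qed

lemma mat_norm_pos:
  fixes A B :: "real^'n^'n"
  assumes "invertible A" "invertible B"
  shows "0 < mat_norm (matrix_inv A ** B)"
proof (rule ccontr)
  assume "\<not> ?thesis"
  then have "mat_norm (matrix_inv A ** B) \<le> 0" by simp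
  then have "\<forall>v. enorm A v \<le> 0" using assms by (simp add: mat_norm_le_iff)
  \<comment> \<open>The all-ones vector \<open>1\<close> serves as a nonzero vector on which
    \<open>enorm A\<close> would have to vanish.\<close>
  then have "(1 :: real^'n) = 0" using enorm_eq_0_iff[OF assms(1)] by (metis enorm_nonneg order_antisym)
  then show False by simp
qed

text \<open>Comparing \<open>A\<close> with \<open>B\<close> and back along one nonzero vector
  returns its own norm, so the two comparison constants multiply to at least 1. This yields the
  middle inequality of the shape condition.\<close>

lemma one_le_mat_norm_mult:
  fixes A B :: "real^'n^'n"
  assumes "invertible A" "invertible B"
  shows "1 \<le> mat_norm (matrix_inv A ** B) * mat_norm (matrix_inv B ** A)" (is "1 \<le> ?a * ?b")
proof -
  define v :: "real^'n" where "v = 1"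
  have "enorm A v \<le> ?a * enorm B v" "enorm B v \<le> ?b * enorm A v"
    using mat_norm_le_iff assms by blast+
  moreover have "0 < ?a" using assms by (rule mat_norm_pos)
  ultimately have "enorm A v \<le> ?a * (?b * enorm A v)"
    by (meson mult_left_mono order.trans less_imp_le)
  moreover have "enorm A v \<noteq> 0" using assms(1) by (simp add: enorm_eq_0_iff v_def)
  ultimately show ?thesis
    by (smt (verit) enorm_nonneg mult.assoc mult_le_cancel_right1)
qed

section \<open>Volumes of ellipsoids and comparison of norms by volume\<close>

lemma measure_ellipsoid_center: "measure lebesgue (ellipsoid M x) = measure lebesgue (ellipsoid M y)"
proof -
  have "ellipsoid M x = (+) (x - y) ` ellipsoid M y"
    by (auto simp: ellipsoid_def image_image algebra_simps)
  then show ?thesis by (simp add: measure_translation)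
qed

lemma compact_ellipsoid: "compact (ellipsoid M x)"
  unfolding ellipsoid_def
  by (intro compact_continuous_image continuous_intros compact_cball
      bounded_linear.continuous_on[OF matrix_vector_mul_bounded_linear])

lemma ellipsoid_lmeasurable: "ellipsoid M x \<in> lmeasurable"
  by (intro lmeasurable_compact compact_ellipsoid)

lemma measure_ellipsoid_scaleR:
  fixes M :: "real^'n^'n"
  shows "measure lebesgue (ellipsoid (Q *\<^sub>R M) x) = \<bar>Q\<bar> ^ CARD('n) * measure lebesgue (ellipsoid M x)"
proof -
  have "ellipsoid (Q *\<^sub>R M) x = (\<lambda>y. Q *\<^sub>R y + (x - Q *\<^sub>R x)) ` ellipsoid M x"
    by (auto simp: ellipsoid_def image_image algebra_simps simp flip: scaleR_matrix_vector_assoc)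
  then show ?thesis
    by (simp add: measure_lebesgue_affine)
qed

lemma measure_ellipsoid_pos:
  assumes "invertible M"
  shows "0 < measure lebesgue (ellipsoid M x)"
proof -
  let ?U = "{u. enorm M (u - x) < 1}"
  have sub: "?U \<subseteq> ellipsoid M x" using assms by (auto simp: mem_ellipsoid)
  have "open ?U" by (intro open_Collect_less continuous_on_enorm continuous_on_const)
  moreover have "x \<in> ?U" by simp
  ultimately have "\<not> negligible ?U" using open_not_negligible by blast
  then have "\<not> negligible (ellipsoid M x)" using sub negligible_subset by blast
  then have "measure lebesgue (ellipsoid M x) \<noteq> 0"
    using ellipsoid_lmeasurable negligible_iff_measure0 by blast
  then show ?thesis by (simp add: zero_less_measure_iff)
qed

text \<open>If \<open>A\<close> is small and \<open>B\<close> is large on \<open>v\<close>, many disjoint translates of the unit ball of \<open>B\<close>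
  along \<open>v\<close> fit into a bounded multiple of the unit ball of \<open>A\<close>.\<close>

lemma enorm_reverse_le:
  fixes A B :: "real^'n^'n"
  assumes inv: "invertible A" "invertible B" and K: "0 < K"
    and le: "\<And>v. enorm A v \<le> K * enorm B v"
  shows "enorm B v \<le>
    (K + 3) ^ CARD('n) * (measure lebesgue (ellipsoid A x) / measure lebesgue (ellipsoid B y)) * enorm A v"
proof (cases "v = 0")
  case True
  then show ?thesis by simp
next
  case False
  let ?\<mu> = "measure lebesgue"
  define a b where "a = enorm A v" and "b = enorm B v"
  have ab: "0 < a" "0 < b"
    using False inv enorm_nonneg unfolding a_def b_def
    by (metis enorm_eq_0_iff order_le_less)+
  \<comment> \<open>The vector \<open>u\<close> has \<open>B\<close>-length 3, so unit
    \<open>B\<close>-balls at distinct multiples of \<open>u\<close> are disjoint. Its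
    \<open>A\<close>-length is \<open>3 * (a / b)\<close>, so the multiples with index below
    \<open>N\<close> have \<open>A\<close>-length at most 3; with \<open>K\<close> for the size of
    each translate this gives \<open>K + 3\<close>.\<close>
  define N where "N = nat \<lceil>b / a\<rceil>"
  define u where "u = (3 / b) *\<^sub>R v"
  have B_u: "enorm B u = 3" and A_u: "enorm A u = 3 * (a / b)"
    using ab by (simp_all add: u_def flip: a_def b_def)
  let ?E = "\<lambda>j::nat. ellipsoid B (real j *\<^sub>R u)"
  have disj: "disjoint_family_on ?E {..<N}"
    unfolding disjoint_family_on_def
  proof (intro ballI impI equals0I)
    fix i j :: nat and z assume "i \<noteq> j" "z \<in> ?E i \<inter> ?E j"
    then have "enorm B (z - real i *\<^sub>R u) \<le> 1" "enorm B (z - real j *\<^sub>R u) \<le> 1"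
      using inv by (auto simp: mem_ellipsoid)
    then have "enorm B (real i *\<^sub>R u - real j *\<^sub>R u) \<le> 2"
      using enorm_triangle_diff[of B "real i *\<^sub>R u" "real j *\<^sub>R u" z]
      by (simp add: enorm_minus_commute[of B "real i *\<^sub>R u" z])
    then have "\<bar>real i - real j\<bar> * 3 \<le> 2"
      by (simp add: B_u flip: scaleR_diff_left)
    moreover have "real i + 1 \<le> real j \<or> real j + 1 \<le> real i"
      using \<open>i \<noteq> j\<close> by linarith
    ultimately show False by (auto simp: abs_if split: if_splits)
  qed
  have sub: "(\<Union>j<N. ?E j) \<subseteq> ellipsoid ((K + 3) *\<^sub>R A) 0"
  proof
    fix z assume "z \<in> (\<Union>j<N. ?E j)"
    then obtain j where j: "j < N" "enorm B (z - real j *\<^sub>R u) \<le> 1"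
      using inv by (auto simp: mem_ellipsoid)
    have "enorm A (z - real j *\<^sub>R u) \<le> K"
      using le[of "z - real j *\<^sub>R u"] mult_left_mono[OF j(2), of K] K by linarith
    moreover have "real j \<le> b / a" using j(1) unfolding N_def by linarith
    then have "enorm A (real j *\<^sub>R u) \<le> 3"
      using ab by (simp add: A_u field_simps)
    ultimately have "enorm A z \<le> K + 3"
      using enorm_triangle[of A "z - real j *\<^sub>R u" "real j *\<^sub>R u"] by simp
    then show "z \<in> ellipsoid ((K + 3) *\<^sub>R A) 0"
      using inv K by (simp add: mem_ellipsoid_scaleR)
  qed
  have "real N * ?\<mu> (ellipsoid B y) = (\<Sum>j<N. ?\<mu> (ellipsoid B y))" by simp
  also have "\<dots> = (\<Sum>j<N. ?\<mu> (?E j))"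
    by (intro sum.cong refl measure_ellipsoid_center)
  also have "\<dots> = ?\<mu> (\<Union>j<N. ?E j)"
  proof (rule measure_finite_Union[symmetric, OF _ _ disj])
    show "?E ` {..<N} \<subseteq> sets lebesgue" using ellipsoid_lmeasurable by blast
    show "emeasure lebesgue (?E j) \<noteq> \<infinity>" for j
      using fmeasurableD2[OF ellipsoid_lmeasurable] by simp
  qed simp
  also have "\<dots> \<le> ?\<mu> (ellipsoid ((K + 3) *\<^sub>R A) 0)"
    by (intro measure_mono_fmeasurable sub ellipsoid_lmeasurable sets.finite_UN fmeasurableD) simp
  also have "\<dots> = (K + 3) ^ CARD('n) * ?\<mu> (ellipsoid A x)"
    using K measure_ellipsoid_center[of A 0 x] by (simp add: measure_ellipsoid_scaleR)
  finally have N: "real N * ?\<mu> (ellipsoid B y) \<le> (K + 3) ^ CARD('n) * ?\<mu> (ellipsoid A x)" .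
  have "b / a * ?\<mu> (ellipsoid B y) \<le> real N * ?\<mu> (ellipsoid B y)"
    unfolding N_def by (intro mult_right_mono) (auto simp: real_nat_ceiling_ge)
  with N have "b / a * ?\<mu> (ellipsoid B y) \<le> (K + 3) ^ CARD('n) * ?\<mu> (ellipsoid A x)" by linarith
  then have "b \<le> (K + 3) ^ CARD('n) * (?\<mu> (ellipsoid A x) / ?\<mu> (ellipsoid B y)) * a"
    using ab measure_ellipsoid_pos[OF inv(2), of y] by (simp add: field_simps)
  then show ?thesis by (simp add: a_def b_def)
qed

section \<open>A measurability criterion for starlike sets\<close>

lemma starlike_lmeasurable:
  fixes U :: "(real^'n) set"
  assumes bdd: "bounded U"
    and star: "\<And>c y. \<lbrakk>0 < c; c < 1; y \<in> U\<rbrakk> \<Longrightarrow> x + c *\<^sub>R (y - x) \<in> interior U"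
  shows "U \<in> lmeasurable"
proof -
  \<comment> \<open>\<open>?f c\<close> is the dilation about \<open>x\<close> by
    \<open>1/c\<close>, the inverse of the contraction in \<open>star\<close>.\<close>
  let ?V = "interior U" and ?f = "\<lambda>c y. (1/c) *\<^sub>R y + (x - (1/c) *\<^sub>R x)"
  have V: "?V \<in> lmeasurable" using bdd by (rule lmeasurable_interior)
  have im: "?f c ` ?V \<in> lmeasurable" if "c \<noteq> 0" for c
  proof -
    have "?f c ` ?V = (+) (x - (1/c) *\<^sub>R x) ` (*\<^sub>R) (1/c) ` ?V"
      by (auto simp: image_image add.commute)
    moreover have "(*\<^sub>R) (1/c) ` ?V \<in> lmeasurable"
      using bdd that
      by (intro lmeasurable_open open_scaling bounded_scaling bounded_interior open_interior) auto
    ultimately show ?thesis by (simp only: measurable_translation)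
  qed
  show ?thesis
    \<comment> \<open>\<open>U\<close> is squeezed between its interior and \<open>?f c\<close>
      applied to that interior. The two measures differ by the factor
      \<open>(1/c) ^ CARD('n)\<close>, which tends to 1 as \<open>c\<close> increases to 1.\<close>
    unfolding completion.fmeasurable_inner_outer
  proof (intro allI impI)
    fix e :: real assume "0 < e"
    let ?m = "measure lebesgue ?V"
    have "((\<lambda>c. \<bar>?m - (1/c) ^ CARD('n) * ?m\<bar>) \<longlongrightarrow> \<bar>?m - (1/1) ^ CARD('n) * ?m\<bar>) (at_left 1)"
      by (intro tendsto_intros) auto
    then have "\<forall>\<^sub>F c in at_left (1::real). \<bar>?m - (1/c) ^ CARD('n) * ?m\<bar> < e"
      using \<open>0 < e\<close> by (intro order_tendstoD) auto
    moreover have "\<forall>\<^sub>F c in at_left (1::real). 0 < c \<and> c < 1"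
      using eventually_at_left_real[of 0 1] by simp
    ultimately obtain c :: real where c: "\<bar>?m - (1/c) ^ CARD('n) * ?m\<bar> < e" "0 < c" "c < 1"
      by (metis (no_types, lifting) eventually_conj eventually_happens trivial_limit_at_left_real)
    have "U \<subseteq> ?f c ` ?V"
    proof
      fix y assume "y \<in> U"
      moreover have "y = ?f c (x + c *\<^sub>R (y - x))"
        using c by (simp add: algebra_simps)
      ultimately show "y \<in> ?f c ` ?V" using star c by blast
    qed
    moreover have "measure lebesgue (?f c ` ?V) = (1/c) ^ CARD('n) * ?m"
      using c by (subst measure_lebesgue_affine) simp
    ultimately show "\<exists>T\<in>lmeasurable. \<exists>W\<in>lmeasurable.
        T \<subseteq> U \<and> U \<subseteq> W \<and> \<bar>measure lebesgue T - measure lebesgue W\<bar> < e"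
      using V im[of c] c interior_subset by (metis less_irrefl)
  qed
qed

subsection \<open>The quasi-distance induced by a continuous ellipsoid cover\<close>

text \<open>Supplies the change of scale after which an exponentially decaying bound falls below a
  prescribed level. It is kept nonnegative because the shape condition speaks of such shifts
  only.\<close>

lemma ex_powr_decay:
  assumes "0 < (a::real)" "0 < e"
  shows "\<exists>s\<ge>0. K * 2 powr (- a * s) \<le> e"
proof (cases "K \<le> e")
  case True
  then show ?thesis by (intro exI[of _ 0]) simp
next
  case False
  define s where "s = max 0 (log 2 (K / e) / a)"
  have "log 2 (K / e) \<le> a * s"
    using assms by (simp add: s_def max_def field_simps)
  then have "2 powr log 2 (K / e) \<le> 2 powr (a * s)" by simp
  then have "K / e \<le> 2 powr (a * s)" using False assms by simp
  then have "K * 2 powr (- a * s) \<le> e"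
    using assms by (simp add: powr_minus field_simps)
  moreover have "0 \<le> s" by (simp add: s_def)
  ultimately show ?thesis by blast
qed

text \<open>The outer inequalities of the shape condition are restated through \<open>enorm\<close>;
  \<open>b3\<close> stands for the reciprocal of the original constant \<open>a3\<close>.\<close>

locale ellipsoid_cover =
  fixes M :: "real^'n \<Rightarrow> real \<Rightarrow> real^'n^'n" and a1 a2 b3 a4 a5 a6 :: real
  assumes pos: "0 < a1" "0 < a2" "0 < b3" "0 < a4" "0 < a5" "0 < a6"
    and inv: "invertible (M x t)"
    and vol_ge: "a1 * 2 powr (- t) \<le> measure lebesgue (ellipsoid (M x t) x)"
    and vol_le: "measure lebesgue (ellipsoid (M x t) x) \<le> a2 * 2 powr (- t)"
    and shape_ge: "\<lbrakk>0 \<le> s; ellipsoid (M x t) x \<inter> ellipsoid (M y (t + s)) y \<noteq> {}\<rbrakk> \<Longrightarrow>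
      enorm (M y (t + s)) v \<le> b3 * 2 powr (a4 * s) * enorm (M x t) v"
    and shape_le: "\<lbrakk>0 \<le> s; ellipsoid (M x t) x \<inter> ellipsoid (M y (t + s)) y \<noteq> {}\<rbrakk> \<Longrightarrow>
      enorm (M x t) v \<le> a5 * 2 powr (- a6 * s) * enorm (M y (t + s)) v"
begin

abbreviation \<theta> where "\<theta> x t \<equiv> ellipsoid (M x t) x"

abbreviation \<rho> where "\<rho> \<equiv> induced_qdist {\<theta> x t |x t. True}"

lemma mem_\<theta>: "y \<in> \<theta> x t \<longleftrightarrow> enorm (M x t) (y - x) \<le> 1"
  using inv by (rule mem_ellipsoid)

lemma center_mem [simp]: "x \<in> \<theta> x t"
  by (simp add: mem_\<theta>)

lemma a1_le_a2: "a1 \<le> a2"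
  using vol_ge[of 0 undefined] vol_le[of undefined 0] by simp

lemma shape_le_const:
  assumes "t \<le> t'" "z \<in> \<theta> x t" "z \<in> \<theta> y t'"
  shows "enorm (M x t) v \<le> a5 * enorm (M y t') v"
proof -
  have "enorm (M x t) v \<le> a5 * 2 powr (- a6 * (t' - t)) * enorm (M y t') v"
    using shape_le[of "t' - t" x t y v] assms by auto
  also have "\<dots> \<le> a5 * 1 * enorm (M y t') v"
    using assms(1) pos powr_mono[of "- a6 * (t' - t)" 0 2]
    by (intro mult_right_mono mult_left_mono) auto
  finally show ?thesis by simp
qed

text \<open>Two points of the finer ellipsoid are at most 2 apart in its own norm, and
  \<open>shape_le_const\<close> carries this over to the coarser norm.\<close>

lemma engulf:
  assumes "t \<le> t'" "z \<in> \<theta> x t" "z \<in> \<theta> y t'" "w \<in> \<theta> y t'"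
  shows "enorm (M x t) (w - z) \<le> 2 * a5"
proof -
  have "enorm (M y t') (w - z) \<le> 2"
    using enorm_triangle_diff[of "M y t'" w z y] assms
    by (simp add: mem_\<theta> enorm_minus_commute[of _ y z])
  then have "a5 * enorm (M y t') (w - z) \<le> a5 * 2" using pos by simp
  with shape_le_const[OF assms(1-3), of "w - z"] show ?thesis by simp
qed

text \<open>Coarsening the scale at a fixed centre shrinks the norm exponentially, so the ellipsoids
  around \<open>x\<close> exhaust the space. Hence the infimum defining \<open>\<rho>\<close> is
  never over an empty set.\<close>

lemma \<theta>_covers: "\<exists>t. y \<in> \<theta> x t"
proof -
  obtain s where s: "0 \<le> s" "a5 * enorm (M x 0) (y - x) * 2 powr (- a6 * s) \<le> 1"
    using ex_powr_decay[of a6 1] pos by auto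
  have "enorm (M x (- s)) (y - x) \<le> a5 * 2 powr (- a6 * s) * enorm (M x 0) (y - x)"
    using shape_le[of s x "- s" x "y - x"] s center_mem by fastforce
  also have "\<dots> \<le> 1" using s by (simp add: mult_ac)
  finally have "y \<in> \<theta> x (- s)" by (simp add: mem_\<theta>)
  then show ?thesis ..
qed

section \<open>Basic facts on the induced quasi-distance\<close>

lemma \<rho>_le: "\<lbrakk>x \<in> \<theta> z t; y \<in> \<theta> z t\<rbrakk> \<Longrightarrow> \<rho> x y \<le> measure lebesgue (\<theta> z t)"
  unfolding induced_qdist_def by (rule cInf_lower) (auto intro!: bdd_belowI[of _ 0])

lemma \<rho>_less:
  assumes "\<rho> x y < r"
  obtains z t where "x \<in> \<theta> z t" "y \<in> \<theta> z t" "measure lebesgue (\<theta> z t) < r"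
proof -
  obtain t where "y \<in> \<theta> x t" using \<theta>_covers by blast
  then have "measure lebesgue (\<theta> x t) \<in>
      {measure lebesgue E |E. E \<in> {\<theta> x t |x t. True} \<and> x \<in> E \<and> y \<in> E}"
    using center_mem by blast
  then show ?thesis
    using cInf_lessD[OF _ assms[unfolded induced_qdist_def]] that by blast
qed

lemma \<rho>_nonneg: "0 \<le> \<rho> x y"
proof (rule ccontr)
  assume "\<not> 0 \<le> \<rho> x y"
  then obtain z t where "measure lebesgue (\<theta> z t) < 0"
    using \<rho>_less[of x y 0] by force
  then show False by (simp add: not_less[symmetric])
qed

lemma \<rho>_commute: "\<rho> x y = \<rho> y x"
  unfolding induced_qdist_def by (simp add: conj_commute)

section \<open>Balls of the induced quasi-distance squeezed between ellipsoids\<close>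

lemma ex_scale:
  assumes "0 < r"
  obtains t where "2 * a2 * 2 powr (- t) = r"
proof
  show "2 * a2 * 2 powr (- (- log 2 (r / (2 * a2)))) = r"
    using assms pos by simp
qed

text \<open>The volume bounds determine the scale of an ellipsoid only up to an additive error. An
  ellipsoid of volume below \<open>2 * a2 * 2 powr (- t)\<close> has scale at least
  \<open>t - scale_gap\<close>.\<close>

definition scale_gap :: real where "scale_gap = log 2 (2 * a2 / a1)"

definition outer_const :: real where "outer_const = 2 * a5 * b3 * 2 powr (a4 * scale_gap)"

lemma powr_scale_gap: "2 powr scale_gap = 2 * a2 / a1"
  using pos by (simp add: scale_gap_def)

lemma scale_gap_nonneg: "0 \<le> scale_gap"
  using pos a1_le_a2 by (simp add: scale_gap_def)

lemma outer_const_pos: "0 < outer_const"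
  using pos by (simp add: outer_const_def)

text \<open>A small ellipsoid through \<open>x\<close> and \<open>y\<close> has scale at least
  \<open>t - scale_gap\<close>, so \<open>engulf\<close> applies around \<open>x\<close> at that
  coarser scale with constant \<open>2 * a5\<close>. Returning to scale \<open>t\<close> costs the
  remaining factor of \<open>outer_const\<close>.\<close>

lemma ball_outer:
  assumes "\<rho> x y < 2 * a2 * 2 powr (- t)"
  shows "enorm (M x t) (y - x) \<le> outer_const"
proof -
  obtain z s where zs: "x \<in> \<theta> z s" "y \<in> \<theta> z s" "measure lebesgue (\<theta> z s) < 2 * a2 * 2 powr (- t)"
    using assms by (rule \<rho>_less)
  have "a1 * 2 powr (- s) < 2 * a2 * 2 powr (- t)"
    using vol_ge zs(3) by (rule le_less_trans)
  then have "2 powr (- s) < 2 powr scale_gap * 2 powr (- t)"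
    using pos by (simp add: powr_scale_gap field_simps)
  then have "2 powr (- s) < 2 powr (scale_gap - t)"
    by (simp add: powr_diff powr_minus divide_inverse)
  then have "t - scale_gap \<le> s" by simp
  then have "enorm (M x (t - scale_gap)) (y - x) \<le> 2 * a5"
    using zs by (intro engulf) auto
  then have "b3 * 2 powr (a4 * scale_gap) * enorm (M x (t - scale_gap)) (y - x) \<le> outer_const"
    using pos mult_left_mono[of _ "2 * a5" "b3 * 2 powr (a4 * scale_gap)"]
    by (simp add: outer_const_def mult_ac)
  moreover have "enorm (M x t) (y - x)
      \<le> b3 * 2 powr (a4 * scale_gap) * enorm (M x (t - scale_gap)) (y - x)"
    using shape_ge[of scale_gap x "t - scale_gap" x "y - x"] scale_gap_nonneg center_mem by fastforce
  ultimately show ?thesis by linarith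
qed

text \<open>The volume of \<open>\<theta> x t\<close> is at most half of the radius; the factor 2 in
  the radius is there to make the inequality strict.\<close>

lemma ball_inner:
  assumes "y \<in> \<theta> x t"
  shows "\<rho> x y < 2 * a2 * 2 powr (- t)"
proof -
  have "\<rho> x y \<le> a2 * 2 powr (- t)"
    using \<rho>_le[OF center_mem assms] vol_le by (rule order_trans)
  moreover have "0 < a2 * 2 powr (- t)" using pos by simp
  ultimately show ?thesis by linarith
qed

section \<open>Separation of points and the quasi-triangle inequality\<close>

lemma \<rho>_eq_0_iff: "\<rho> x y = 0 \<longleftrightarrow> x = y"
proof
  assume "\<rho> x y = 0"
  \<comment> \<open>At distance zero, \<open>y\<close> stays in a fixed multiple of
    \<open>\<theta> x t\<close> at every scale. Letting the scale become finer, the decay in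
    \<open>shape_le\<close> forces the norm at scale 0 to vanish.\<close>
  then have outer: "enorm (M x t) (y - x) \<le> outer_const" for t
    using pos by (intro ball_outer) simp
  have "enorm (M x 0) (y - x) \<le> e" if e: "0 < e" for e
  proof -
    obtain s where s: "0 \<le> s" "(a5 * outer_const) * 2 powr (- a6 * s) \<le> e"
      using ex_powr_decay[OF pos(6) e] by blast
    have "enorm (M x 0) (y - x) \<le> a5 * 2 powr (- a6 * s) * enorm (M x s) (y - x)"
      using shape_le[of s x 0 x "y - x"] s center_mem by fastforce
    also have "\<dots> \<le> a5 * 2 powr (- a6 * s) * outer_const"
      using outer pos by (intro mult_left_mono) auto
    finally show ?thesis using s by (simp add: mult_ac)
  qed
  then have "enorm (M x 0) (y - x) = 0"
    by (meson enorm_nonneg dense_ge order_antisym)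
  then show "x = y" using inv by (simp add: enorm_eq_0_iff)
next
  assume "x = y"
  have "\<rho> x y \<le> e" if e: "0 < e" for e
  proof -
    obtain t where "2 * a2 * 2 powr (- t) = e" using e by (rule ex_scale)
    then show ?thesis using ball_inner[of y x t] \<open>x = y\<close> by simp
  qed
  then have "\<rho> x y \<le> 0" by (meson dense_ge)
  then show "\<rho> x y = 0" using \<rho>_nonneg[of x y] by simp
qed

text \<open>Both \<open>x\<close> and \<open>w\<close> lie in the dilation by
  \<open>1 + 2 * a5\<close> of the coarser ellipsoid. Coarsening its scale by \<open>L\<close>
  absorbs this factor, so the single ellipsoid \<open>\<theta> z (s - L)\<close> contains both
  points, and its volume is comparable.\<close>

lemma \<rho>_le_union:
  assumes L: "0 \<le> L" "a5 * (1 + 2 * a5) * 2 powr (- a6 * L) \<le> 1"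
    and "x \<in> \<theta> z s" "y \<in> \<theta> z s" "y \<in> \<theta> z' s'" "w \<in> \<theta> z' s'" "s \<le> s'"
  shows "\<rho> x w \<le> a2 / a1 * 2 powr L * measure lebesgue (\<theta> z s)"
proof -
  have "enorm (M z s) (w - z) \<le> enorm (M z s) (w - y) + enorm (M z s) (y - z)"
    by (rule enorm_triangle_diff)
  also have "\<dots> \<le> 2 * a5 + 1"
    using engulf assms(4-7) by (intro add_mono) (auto simp: mem_\<theta>)
  finally have w: "enorm (M z s) (w - z) \<le> 1 + 2 * a5" by simp
  have x: "enorm (M z s) (x - z) \<le> 1 + 2 * a5"
    using assms(3) pos by (simp add: mem_\<theta>)
  have "u \<in> \<theta> z (s - L)" if "enorm (M z s) (u - z) \<le> 1 + 2 * a5" for u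
  proof -
    have "enorm (M z (s - L)) (u - z) \<le> a5 * 2 powr (- a6 * L) * enorm (M z s) (u - z)"
      using shape_le[of L z "s - L" z "u - z"] L center_mem by fastforce
    also have "\<dots> \<le> a5 * 2 powr (- a6 * L) * (1 + 2 * a5)"
      using that pos by (intro mult_left_mono) auto
    finally show ?thesis using L by (simp add: mem_\<theta> mult_ac)
  qed
  then have "\<rho> x w \<le> measure lebesgue (\<theta> z (s - L))" using x w by (intro \<rho>_le) auto
  also have "\<dots> \<le> a2 * 2 powr (- (s - L))" by (rule vol_le)
  also have "\<dots> = a2 / a1 * 2 powr L * (a1 * 2 powr (- s))"
    using pos by (simp add: powr_diff powr_minus field_simps)
  also have "\<dots> \<le> a2 / a1 * 2 powr L * measure lebesgue (\<theta> z s)"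
    using vol_ge pos by (intro mult_left_mono) auto
  finally show ?thesis .
qed

lemma \<rho>_quasi_triangle: "\<exists>\<kappa>\<ge>1. \<forall>x y w. \<rho> x w \<le> \<kappa> * (\<rho> x y + \<rho> y w)"
proof -
  obtain L where L: "0 \<le> L" "a5 * (1 + 2 * a5) * 2 powr (- a6 * L) \<le> 1"
    using ex_powr_decay[of a6 1] pos by auto
  define \<kappa> where "\<kappa> = a2 / a1 * 2 powr L"
  have "1 * 1 \<le> \<kappa>" unfolding \<kappa>_def
    using pos a1_le_a2 L ge_one_powr_ge_zero[of 2 L] by (intro mult_mono) auto
  then have \<kappa>: "1 \<le> \<kappa>" by simp
  have le: "\<rho> x w \<le> \<kappa> * (\<rho> x y + \<rho> y w) + e" if "0 < e" for x y w e
  proof -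
    \<comment> \<open>Each of the two nearly optimal ellipsoids overshoots by \<open>d\<close>;
      together, after multiplication by \<open>\<kappa>\<close>, they cost exactly
      \<open>e\<close>.\<close>
    define d where "d = e / (2 * \<kappa>)"
    have "0 < d" using that \<kappa> by (simp add: d_def)
    then obtain z s where 1: "x \<in> \<theta> z s" "y \<in> \<theta> z s" "measure lebesgue (\<theta> z s) < \<rho> x y + d"
      using \<rho>_less[of x y "\<rho> x y + d"] by auto
    obtain z' s' where 2: "y \<in> \<theta> z' s'" "w \<in> \<theta> z' s'" "measure lebesgue (\<theta> z' s') < \<rho> y w + d"
      using \<open>0 < d\<close> \<rho>_less[of y w "\<rho> y w + d"] by auto
    have "\<rho> x w \<le> \<kappa> * (measure lebesgue (\<theta> z s) + measure lebesgue (\<theta> z' s'))"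
    proof (cases "s \<le> s'")
      case True
      then have "\<rho> x w \<le> \<kappa> * measure lebesgue (\<theta> z s)"
        using \<rho>_le_union[OF L] 1 2 by (simp add: \<kappa>_def)
      also have "\<dots> \<le> \<kappa> * (measure lebesgue (\<theta> z s) + measure lebesgue (\<theta> z' s'))"
        using \<kappa> by simp
      finally show ?thesis .
    next
      case False
      \<comment> \<open>When the second ellipsoid is the coarser one, the chain is traversed
        backwards, from \<open>w\<close> through \<open>y\<close> to \<open>x\<close>.\<close>
      then have "\<rho> w x \<le> \<kappa> * measure lebesgue (\<theta> z' s')"
        using \<rho>_le_union[OF L] 1 2 by (simp add: \<kappa>_def)
      also have "\<dots> \<le> \<kappa> * (measure lebesgue (\<theta> z s) + measure lebesgue (\<theta> z' s'))"
        using \<kappa> by simp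
      finally show ?thesis by (subst \<rho>_commute)
    qed
    also have "\<dots> \<le> \<kappa> * (\<rho> x y + d + (\<rho> y w + d))"
      using 1 2 \<kappa> by (intro mult_left_mono) auto
    also have "\<dots> = \<kappa> * (\<rho> x y + \<rho> y w) + e"
      using \<kappa> by (simp add: d_def field_simps)
    finally show ?thesis .
  qed
  have "\<rho> x w \<le> \<kappa> * (\<rho> x y + \<rho> y w)" for x y w
    by (rule field_le_epsilon) (rule le)
  then show ?thesis using \<kappa> by (intro exI[of _ \<kappa>]) simp
qed

lemma \<rho>_quasi_distance: "quasi_distance \<rho>"
  unfolding quasi_distance_def
proof (intro conjI allI \<rho>_nonneg)
  obtain \<kappa> where "1 \<le> \<kappa>" "\<forall>x y w. \<rho> x w \<le> \<kappa> * (\<rho> x y + \<rho> y w)"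
    using \<rho>_quasi_triangle by blast
  then show "\<exists>\<kappa>\<ge>1. \<forall>x y z. (\<rho> x y = 0 \<longleftrightarrow> x = y) \<and> \<rho> x y = \<rho> y x \<and>
      \<rho> x z \<le> \<kappa> * (\<rho> x y + \<rho> y z)"
    by (intro exI[of _ \<kappa>] conjI allI \<rho>_eq_0_iff \<rho>_commute) auto
qed

section \<open>Quasi-convexity of the induced quasi-distance\<close>

lemma qball_subset_outer:
  assumes "2 * a2 * 2 powr (- t) = r" "outer_const \<le> Q"
  shows "qball \<rho> x r \<subseteq> ellipsoid (Q *\<^sub>R M x t) x"
proof
  fix y assume "y \<in> qball \<rho> x r"
  then have "enorm (M x t) (y - x) \<le> outer_const"
    using assms by (intro ball_outer) (simp add: qball_def)
  then show "y \<in> ellipsoid (Q *\<^sub>R M x t) x"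
    using assms(2) outer_const_pos inv by (simp add: mem_ellipsoid_scaleR)
qed

lemma inner_subset_qball: "2 * a2 * 2 powr (- t) = r \<Longrightarrow> \<theta> x t \<subseteq> qball \<rho> x r"
  using ball_inner by (auto simp: qball_def)

lemma \<rho>_quasi_convex: "quasi_convex \<rho>"
  unfolding quasi_convex_def
proof (intro exI[of _ "max 1 outer_const"] conjI allI impI)
  fix x and r :: real assume "0 < r"
  then obtain t where t: "2 * a2 * 2 powr (- t) = r" by (rule ex_scale)
  show "\<exists>M. invertible M \<and> ellipsoid M x \<subseteq> qball \<rho> x r \<and>
      qball \<rho> x r \<subseteq> ellipsoid (max 1 outer_const *\<^sub>R M) x"
    by (intro exI[of _ "M x t"] conjI inv inner_subset_qball qball_subset_outer t) simp
qed simp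

section \<open>Measurability of balls and Ahlfors regularity\<close>

lemma strict_interior_\<theta>:
  assumes "x \<in> \<theta> z t" "y \<in> \<theta> z t" "x \<noteq> y" "0 < c" "c < 1"
  shows "enorm (M z t) (x + c *\<^sub>R (y - x) - z) < 1"
proof -
  \<comment> \<open>This affine map carries \<open>\<theta> z t\<close> to the Euclidean unit ball,
    whose strict convexity puts the open segment between two distinct points into the open
    ball.\<close>
  let ?f = "\<lambda>u. matrix_inv (M z t) *v (u - z)"
  have "?f x \<noteq> ?f y"
  proof
    assume "?f x = ?f y"
    then have "enorm (M z t) (x - y) = 0"
      by (simp add: enorm_def matrix_vector_mult_diff_distrib)
    then show False using inv assms(3) by (simp add: enorm_eq_0_iff)
  qed
  moreover have "?f (x + c *\<^sub>R (y - x)) = (1 - c) *\<^sub>R ?f x + c *\<^sub>R ?f y"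
    by (simp add: matrix_vector_mult_diff_distrib matrix_vector_right_distrib
        matrix_vector_mult_scaleR algebra_simps)
  ultimately have "?f (x + c *\<^sub>R (y - x)) \<in> open_segment (?f x) (?f y)"
    using assms(4,5) by (auto simp: in_segment)
  from dist_decreases_open_segment[OF this, of 0] show ?thesis
    using assms(1,2) by (auto simp: mem_\<theta> enorm_def)
qed

text \<open>A ball around \<open>x\<close> is the union of the ellipsoids that contain
  \<open>x\<close> and have volume below \<open>r\<close>; the open part of each of them is
  therefore interior to the ball.\<close>

lemma strict_subset_interior_qball:
  assumes "x \<in> \<theta> z t" "measure lebesgue (\<theta> z t) < r"
  shows "{u. enorm (M z t) (u - z) < 1} \<subseteq> interior (qball \<rho> x r)"
proof (rule interior_maximal)
  show "open {u. enorm (M z t) (u - z) < 1}"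
    by (intro open_Collect_less continuous_on_enorm continuous_on_const)
  show "{u. enorm (M z t) (u - z) < 1} \<subseteq> qball \<rho> x r"
  proof
    fix u assume "u \<in> {u. enorm (M z t) (u - z) < 1}"
    then have "u \<in> \<theta> z t" by (simp add: mem_\<theta>)
    then show "u \<in> qball \<rho> x r"
      using \<rho>_le[OF assms(1)] assms(2) by (fastforce simp: qball_def)
  qed
qed

lemma qball_lmeasurable:
  assumes "0 < r"
  shows "qball \<rho> x r \<in> lmeasurable"
proof (rule starlike_lmeasurable)
  obtain t where t: "2 * a2 * 2 powr (- t) = r" using assms by (rule ex_scale)
  show "bounded (qball \<rho> x r)"
    by (rule bounded_subset[OF compact_imp_bounded[OF compact_ellipsoid]
          qball_subset_outer[OF t order_refl]])
  fix c :: real and y assume c: "0 < c" "c < 1" and y: "y \<in> qball \<rho> x r"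
  show "x + c *\<^sub>R (y - x) \<in> interior (qball \<rho> x r)"
  proof (cases "x = y")
    case True
    \<comment> \<open>The segment degenerates here, so the centre is shown to be interior by means
      of \<open>\<theta> x t\<close>, whose volume is at most \<open>r / 2\<close>.\<close>
    have "0 < a2 * 2 powr (- t)" using pos by simp
    then have "measure lebesgue (\<theta> x t) < r" using vol_le[of x t] t by linarith
    from strict_subset_interior_qball[OF center_mem this] show ?thesis
      using True by (auto simp: subset_iff)
  next
    case False
    from y obtain z s where "x \<in> \<theta> z s" "y \<in> \<theta> z s" "measure lebesgue (\<theta> z s) < r"
      unfolding qball_def using \<rho>_less by blast
    then show ?thesis
      using strict_interior_\<theta>[OF _ _ False c] strict_subset_interior_qball by blast
  qed
qed

lemma \<rho>_ahlfors_regular: "ahlfors_regular_1 \<rho>"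
  unfolding ahlfors_regular_1_def
\<comment> \<open>The first entry comes from the inner ellipsoid, of volume at least
  \<open>a1 / (2 * a2) * r\<close>; the second from the outer one, a dilation by
  \<open>outer_const\<close> of an ellipsoid of volume at most \<open>r\<close>.\<close>
proof (intro exI[of _ "max (2 * a2 / a1) (outer_const ^ CARD('n))"] conjI allI impI)
  let ?c = "max (2 * a2 / a1) (outer_const ^ CARD('n))"
  show "1 \<le> ?c" using pos a1_le_a2 by (simp add: le_max_iff_disj)
  fix x and r :: real assume r: "0 < r"
  then obtain t where t: "2 * a2 * 2 powr (- t) = r" by (rule ex_scale)
  show meas: "qball \<rho> x r \<in> lmeasurable" using r by (rule qball_lmeasurable)
  have "1 / ?c \<le> 1 / (2 * a2 / a1)" 
    using pos by (intro divide_left_mono) (auto simp: less_max_iff_disj)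
  then have "1 / ?c * r \<le> 1 / (2 * a2 / a1) * r"
    using r by (intro mult_right_mono) auto
  also have "\<dots> = a1 * 2 powr (- t)" unfolding t[symmetric] using pos by simp
  also have "\<dots> \<le> measure lebesgue (\<theta> x t)" by (rule vol_ge)
  also have "\<dots> \<le> measure lebesgue (qball \<rho> x r)"
    by (intro measure_mono_fmeasurable inner_subset_qball t fmeasurableD ellipsoid_lmeasurable meas)
  finally show "1 / ?c * r \<le> measure lebesgue (qball \<rho> x r)" .
  have "measure lebesgue (qball \<rho> x r) \<le> measure lebesgue (ellipsoid (outer_const *\<^sub>R M x t) x)"
    by (intro measure_mono_fmeasurable qball_subset_outer t fmeasurableD ellipsoid_lmeasurable meas order_refl)
  also have "\<dots> = outer_const ^ CARD('n) * measure lebesgue (\<theta> x t)"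
    using outer_const_pos by (simp add: measure_ellipsoid_scaleR)
  also have "\<dots> \<le> ?c * r"
  proof (rule mult_mono)
    have "0 < a2 * 2 powr (- t)" using pos by simp
    then show "measure lebesgue (\<theta> x t) \<le> r" using vol_le[of x t] t by linarith
  qed (use pos in \<open>auto simp: le_max_iff_disj\<close>)
  finally show "measure lebesgue (qball \<rho> x r) \<le> ?c * r" .
qed

end

section \<open>Passage from an arbitrary continuous cover to the locale\<close>

lemma continuous_ellipsoid_cover_imp_locale:
  fixes \<theta> :: "real^'n \<Rightarrow> real \<Rightarrow> (real^'n) set"
  assumes "continuous_ellipsoid_cover \<theta>"
  obtains M a1 a2 b3 a4 a5 a6
  where "ellipsoid_cover M a1 a2 b3 a4 a5 a6" "\<theta> = (\<lambda>x t. ellipsoid (M x t) x)"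
proof -
  from assms obtain M a1 a2 a3 a4 a5 a6 where
    pos: "a1 > 0" "a2 > 0" "a3 > 0" "a4 > 0" "a5 > 0" "a6 > 0" and
    1: "\<And>x t. invertible (M x t) \<and> \<theta> x t = ellipsoid (M x t) x \<and>
          a1 * 2 powr (- t) \<le> measure lebesgue (\<theta> x t) \<and>
          measure lebesgue (\<theta> x t) \<le> a2 * 2 powr (- t)" and
    2: "\<And>x y t s. s \<ge> 0 \<Longrightarrow> \<theta> x t \<inter> \<theta> y (t + s) \<noteq> {} \<Longrightarrow>
          a3 * 2 powr (- a4 * s) \<le> 1 / mat_norm (matrix_inv (M y (t + s)) ** M x t) \<and>
          mat_norm (matrix_inv (M x t) ** M y (t + s)) \<le> a5 * 2 powr (- a6 * s)"
    unfolding continuous_ellipsoid_cover_def by metis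
  have inv: "invertible (M x t)" for x t using 1 by blast
  have eq: "\<theta> x t = ellipsoid (M x t) x" for x t using 1 by blast
  have "ellipsoid_cover M a1 a2 (1 / a3) a4 a5 a6"
  proof
    fix x y t s v assume "0 \<le> (s::real)" "ellipsoid (M x t) x \<inter> ellipsoid (M y (t + s)) y \<noteq> {}"
    then have s: "a3 * 2 powr (- a4 * s) \<le> 1 / mat_norm (matrix_inv (M y (t + s)) ** M x t)"
        "mat_norm (matrix_inv (M x t) ** M y (t + s)) \<le> a5 * 2 powr (- a6 * s)"
      using 2[of s x t y] by (simp_all add: eq)
    have "mat_norm (matrix_inv (M y (t + s)) ** M x t) \<le> 1 / a3 * 2 powr (a4 * s)"
      using s(1) pos mat_norm_pos[OF inv inv, of y "t + s" x t]
      by (simp add: powr_minus field_simps)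
    then show "enorm (M y (t + s)) v \<le> 1 / a3 * 2 powr (a4 * s) * enorm (M x t) v"
      using inv by (simp add: mat_norm_le_iff)
    show "enorm (M x t) v \<le> a5 * 2 powr (- a6 * s) * enorm (M y (t + s)) v"
      using s(2) inv by (simp add: mat_norm_le_iff)
  qed (use pos 1 eq in auto)
  moreover have "\<theta> = (\<lambda>x t. ellipsoid (M x t) x)" using eq by (intro ext)
  ultimately show ?thesis by (rule that)
qed

lemma continuous_ellipsoid_cover_imp_qdist:
  fixes \<theta> :: "real^'n \<Rightarrow> real \<Rightarrow> (real^'n) set"
  assumes "continuous_ellipsoid_cover \<theta>"
  shows "quasi_distance (induced_qdist {\<theta> x t |x t. True}) \<and>
    quasi_convex (induced_qdist {\<theta> x t |x t. True}) \<and>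
    ahlfors_regular_1 (induced_qdist {\<theta> x t |x t. True})"
proof -
  obtain M a1 a2 b3 a4 a5 a6
    where "ellipsoid_cover M a1 a2 b3 a4 a5 a6" and eq: "\<theta> = (\<lambda>x t. ellipsoid (M x t) x)"
    using assms by (rule continuous_ellipsoid_cover_imp_locale)
  then interpret ellipsoid_cover M a1 a2 b3 a4 a5 a6 by simp
  show ?thesis
    unfolding eq using \<rho>_quasi_distance \<rho>_quasi_convex \<rho>_ahlfors_regular by blast
qed

subsection \<open>The cover induced by a quasi-distance\<close>

text \<open>The two sets have different centres. For antipodal points \<open>y + u\<close> and
  \<open>y - u\<close> on the unit sphere of \<open>B\<close> the unknown offset
  \<open>y - x\<close> cancels in the difference \<open>2 *\<^sub>R u\<close>, so no factor is
  lost.\<close>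

lemma enorm_le_of_translated_inclusion:
  assumes "invertible B" and sub: "\<And>w. enorm B (w - y) \<le> 1 \<Longrightarrow> enorm A (w - x) \<le> Q"
  shows "enorm A v \<le> Q * enorm B v"
proof (cases "v = 0")
  case True
  then show ?thesis by simp
next
  case False
  then have pos: "0 < enorm B v"
    using assms(1) enorm_eq_0_iff enorm_nonneg by (metis order_le_less)
  define u where "u = (1 / enorm B v) *\<^sub>R v"
  have "enorm B u = 1" using pos by (simp add: u_def)
  then have "enorm A (y + u - x) \<le> Q" "enorm A (y - u - x) \<le> Q"
    using sub[of "y + u"] sub[of "y - u"] enorm_minus_commute[of B 0 u] by simp_all
  then have "enorm A ((y + u) - (y - u)) \<le> 2 * Q"
    using enorm_triangle_diff[of A "y + u" "y - u" x] enorm_minus_commute[of A "y - u" x] by linarith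
  moreover have "(y + u) - (y - u) = 2 *\<^sub>R u" by (simp add: scaleR_2)
  ultimately have "enorm A u \<le> Q" by simp
  then show ?thesis using pos by (simp add: u_def field_simps)
qed

text \<open>Ahlfors regularity is recorded as volume bounds for the ellipsoids instead of the balls;
  \<open>inner\<close> and \<open>outer\<close> are the two inclusions of quasi-convexity.\<close>

locale regular_ellipsoids =
  fixes \<rho> :: "real^'n \<Rightarrow> real^'n \<Rightarrow> real" and M :: "real^'n \<Rightarrow> real \<Rightarrow> real^'n^'n"
    and \<kappa> Q V :: real
  assumes ge1: "1 \<le> \<kappa>" "1 \<le> Q" "1 \<le> V"
    and \<rho>_nonneg: "0 \<le> \<rho> x y"
    and \<rho>_refl: "\<rho> x x = 0"
    and \<rho>_commute: "\<rho> x y = \<rho> y x"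
    and \<rho>_triangle: "\<rho> x z \<le> \<kappa> * (\<rho> x y + \<rho> y z)"
    and inv: "0 < r \<Longrightarrow> invertible (M x r)"
    and inner: "\<lbrakk>0 < r; enorm (M x r) (y - x) \<le> 1\<rbrakk> \<Longrightarrow> \<rho> x y < r"
    and outer: "\<lbrakk>0 < r; \<rho> x y < r\<rbrakk> \<Longrightarrow> enorm (M x r) (y - x) \<le> Q"
    and vol_ge: "0 < r \<Longrightarrow> r / V \<le> measure lebesgue (ellipsoid (M x r) x)"
    and vol_le: "0 < r \<Longrightarrow> measure lebesgue (ellipsoid (M x r) x) \<le> V * r"
begin

lemma mem: "0 < r \<Longrightarrow> y \<in> ellipsoid (M x r) x \<longleftrightarrow> enorm (M x r) (y - x) \<le> 1"
  using inv by (rule mem_ellipsoid)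

lemma ellipsoid_subset_qball: "0 < r \<Longrightarrow> y \<in> ellipsoid (M x r) x \<Longrightarrow> \<rho> x y < r"
  using mem inner by blast

lemma \<rho>_triangle_less:
  assumes "\<rho> x y < a" "\<rho> y z < b"
  shows "\<rho> x z < \<kappa> * (a + b)"
proof -
  have "\<rho> x z \<le> \<kappa> * (\<rho> x y + \<rho> y z)" by (rule \<rho>_triangle)
  also have "\<dots> < \<kappa> * (a + b)" using assms ge1 by (intro mult_strict_left_mono) auto
  finally show ?thesis .
qed

section \<open>Engulfing of balls and comparison of norms\<close>

definition engulf_const :: real where "engulf_const = \<kappa> * (2 * \<kappa> + 1)"

lemma engulf_const_ge1: "1 \<le> engulf_const"
  using ge1 mult_mono[of 1 \<kappa> 1 "2 * \<kappa> + 1"] by (simp add: engulf_const_def)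

text \<open>Two uses of the quasi-triangle inequality along \<open>x\<close>, \<open>z\<close>,
  \<open>y\<close>, \<open>w\<close>, with \<open>r'\<close> bounded by \<open>r\<close>, produce
  \<open>engulf_const\<close>.\<close>

lemma ball_engulf:
  assumes "0 < r'" "r' \<le> r" "\<rho> x z < r" "\<rho> y z < r'" "\<rho> y w < r'"
  shows "\<rho> x w < engulf_const * r"
proof -
  have "\<rho> x y < \<kappa> * (r + r')"
    using \<rho>_triangle_less[OF assms(3)] assms(4) by (simp add: \<rho>_commute[of z y])
  from \<rho>_triangle_less[OF this assms(5)]
  have "\<rho> x w < \<kappa> * (\<kappa> * (r + r') + r')" .
  also have "\<dots> \<le> \<kappa> * (\<kappa> * (r + r) + r)"
    using assms ge1 by (intro mult_left_mono add_mono) auto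
  also have "\<dots> = engulf_const * r" by (simp add: engulf_const_def algebra_simps)
  finally show ?thesis .
qed

lemma enorm_engulf:
  assumes "0 < r'" "r' \<le> r" "\<rho> x z < r" "\<rho> y z < r'"
  shows "enorm (M x (engulf_const * r)) v \<le> Q * enorm (M y r') v"
proof (rule enorm_le_of_translated_inclusion)
  show "invertible (M y r')" using assms by (intro inv)
  fix w assume "enorm (M y r') (w - y) \<le> 1"
  then have "\<rho> y w < r'" using assms by (intro inner)
  moreover have "0 < engulf_const * r" using assms engulf_const_ge1 by simp
  ultimately show "enorm (M x (engulf_const * r)) (w - x) \<le> Q"
    using ball_engulf[OF assms] by (intro outer)
qed

text \<open>Regularity bounds the volume ratio in \<open>enorm_reverse_le\<close> by
  \<open>V\<^sup>2 * (r / r')\<close>.\<close>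

lemma enorm_reverse:
  assumes "0 < r" "0 < r'" "0 < K" and le: "\<And>v. enorm (M x r) v \<le> K * enorm (M y r') v"
  shows "enorm (M y r') v \<le> (K + 3) ^ CARD('n) * V\<^sup>2 * (r / r') * enorm (M x r) v"
proof -
  have "enorm (M y r') v \<le> (K + 3) ^ CARD('n) *
      (measure lebesgue (ellipsoid (M x r) x) / measure lebesgue (ellipsoid (M y r') y)) * enorm (M x r) v"
    using assms by (intro enorm_reverse_le inv)
  also have "\<dots> \<le> (K + 3) ^ CARD('n) * ((V * r) / (r' / V)) * enorm (M x r) v"
    using assms ge1 vol_le vol_ge
    by (intro mult_right_mono mult_left_mono frac_le) auto
  also have "(V * r) / (r' / V) = V\<^sup>2 * (r / r')"
    by (simp add: power2_eq_square)
  finally show ?thesis by (simp add: mult_ac)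
qed

definition compare_const :: real where "compare_const = (Q + 3) ^ CARD('n) * V\<^sup>2 * engulf_const * Q"

lemma compare_const_ge1: "1 \<le> compare_const"
proof -
  have "1 * 1 * 1 * 1 \<le> compare_const"
    unfolding compare_const_def using ge1 engulf_const_ge1
    by (intro mult_mono one_le_power mult_nonneg_nonneg) auto
  then show ?thesis by simp
qed

text \<open>Removes the enlargement of the radius in \<open>enorm_engulf\<close>. At the fixed
  centre \<open>x\<close> the radii \<open>r\<close> and \<open>engulf_const * r\<close> have a
  bounded ratio, so \<open>enorm_reverse\<close> returns to radius \<open>r\<close> at the cost of a
  constant.\<close>

lemma enorm_compare:
  assumes "0 < r'" "r' \<le> r" "\<rho> x z < r" "\<rho> y z < r'"
  shows "enorm (M x r) v \<le> compare_const * enorm (M y r') v"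
proof -
  have r: "0 < r" "0 < engulf_const * r" using assms engulf_const_ge1 by auto
  have "enorm (M x r) v \<le> (Q + 3) ^ CARD('n) * V\<^sup>2 * (engulf_const * r / r) * enorm (M x (engulf_const * r)) v"
    using r ge1 by (intro enorm_reverse enorm_engulf[of r r x x]) (auto simp: \<rho>_refl)
  also have "engulf_const * r / r = engulf_const" using r by simp
  also have "(Q + 3) ^ CARD('n) * V\<^sup>2 * engulf_const * enorm (M x (engulf_const * r)) v
      \<le> (Q + 3) ^ CARD('n) * V\<^sup>2 * engulf_const * (Q * enorm (M y r') v)"
    using ge1 engulf_const_ge1 by (intro mult_left_mono enorm_engulf[OF assms]) auto
  finally show ?thesis by (simp add: compare_const_def mult_ac)
qed

section \<open>Growth of balls and decay of norms\<close>

definition \<delta> :: real where "\<delta> = 1 / (compare_const * Q)"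

lemma \<delta>_pos: "0 < \<delta>"
  using compare_const_ge1 ge1 by (simp add: \<delta>_def)

text \<open>The ellipsoid around a point \<open>w\<close> of the ball contains the point \<open>w + \<delta> (w - x)\<close>, so balls grow
  by a definite factor in every direction when the radius is multiplied by \<open>2 \<kappa>\<close>.\<close>

lemma ball_grows:
  assumes "0 < s" "\<rho> x w < s"
  shows "\<rho> x (x + (1 + \<delta>) *\<^sub>R (w - x)) < 2 * \<kappa> * s"
proof -
  have "enorm (M w s) (w - x) \<le> compare_const * enorm (M x s) (w - x)"
    using assms by (intro enorm_compare[of _ _ _ w]) (auto simp: \<rho>_refl)
  also have "\<dots> \<le> compare_const * Q"
    using assms compare_const_ge1 by (intro mult_left_mono outer) auto
  \<comment> \<open>The constant \<open>\<delta>\<close> is the reciprocal of the bound just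
    obtained.\<close>
  finally have "enorm (M w s) (\<delta> *\<^sub>R (w - x)) \<le> 1"
    unfolding enorm_scaleR using compare_const_ge1 ge1 by (simp add: \<delta>_def field_simps)
  then have "enorm (M w s) ((x + (1 + \<delta>) *\<^sub>R (w - x)) - w) \<le> 1"
    by (simp add: algebra_simps)
  with assms(1) have "\<rho> w (x + (1 + \<delta>) *\<^sub>R (w - x)) < s" by (rule inner)
  from \<rho>_triangle_less[OF assms(2) this] show ?thesis by (simp add: mult_ac)
qed

lemma ball_grows_iter:
  assumes "0 < s" "\<rho> x w < s"
  shows "\<rho> x (x + (1 + \<delta>) ^ k *\<^sub>R (w - x)) < (2 * \<kappa>) ^ k * s"
proof (induction k)
  case 0
  then show ?case using assms by simp
next
  case (Suc k)
  have "0 < (2 * \<kappa>) ^ k * s" using assms ge1 by simp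
  from ball_grows[OF this Suc] show ?case by (simp add: mult_ac)
qed

text \<open>Pushing the smaller ellipsoid out from \<open>x\<close> by the factor
  \<open>(1 + \<delta>) ^ k\<close> keeps it inside the larger ball, where \<open>outer\<close>
  bounds the norm by \<open>Q\<close>; dividing by the factor gives the decay.\<close>

lemma enorm_decay:
  assumes "0 < s"
  shows "enorm (M x ((2 * \<kappa>) ^ k * s)) v \<le> Q / (1 + \<delta>) ^ k * enorm (M x s) v"
proof (rule enorm_le_of_translated_inclusion)
  show "invertible (M x s)" using assms by (rule inv)
  fix w assume "enorm (M x s) (w - x) \<le> 1"
  with assms have "\<rho> x w < s" by (rule inner)
  then have "\<rho> x (x + (1 + \<delta>) ^ k *\<^sub>R (w - x)) < (2 * \<kappa>) ^ k * s"
    using assms by (intro ball_grows_iter)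
  moreover have "0 < (2 * \<kappa>) ^ k * s" using assms ge1 by simp
  ultimately have "enorm (M x ((2 * \<kappa>) ^ k * s)) (x + (1 + \<delta>) ^ k *\<^sub>R (w - x) - x) \<le> Q"
    by (intro outer)
  then have "(1 + \<delta>) ^ k * enorm (M x ((2 * \<kappa>) ^ k * s)) (w - x) \<le> Q"
    using \<delta>_pos by simp
  then show "enorm (M x ((2 * \<kappa>) ^ k * s)) (w - x) \<le> Q / (1 + \<delta>) ^ k"
    using \<delta>_pos by (simp add: pos_le_divide_eq mult.commute)
qed

section \<open>The shape condition\<close>

definition decay_rate :: real where "decay_rate = log 2 (1 + \<delta>) / log 2 (2 * \<kappa>)"

lemma decay_rate_pos: "0 < decay_rate"
  using \<delta>_pos ge1 by (simp add: decay_rate_def)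

text \<open>At the centre \<open>y\<close> the radius is enlarged by powers of
  \<open>2 * \<kappa>\<close>, each gaining a factor \<open>1 + \<delta>\<close>, as long as it
  stays below \<open>r\<close>. Then \<open>enorm_compare\<close> passes to the centre
  \<open>x\<close>.\<close>

lemma shape_le:
  assumes "0 < r" "0 \<le> s" "\<rho> x z < r" "\<rho> y z < r * 2 powr (- s)"
  shows "enorm (M x r) v \<le> compare_const * Q * (1 + \<delta>) * 2 powr (- decay_rate * s) * enorm (M y (r * 2 powr (- s))) v"
proof -
  define l where "l = log 2 (2 * \<kappa>)"
  \<comment> \<open>The number of full factors \<open>2 * \<kappa>\<close> in the ratio
    \<open>2 powr s\<close> of the radii. Rounding down accounts for the extra factor
    \<open>1 + \<delta>\<close> in the constant.\<close>
  define k where "k = nat \<lfloor>s / l\<rfloor>"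
  define r' where "r' = r * 2 powr (- s)"
  have l: "0 < l" using ge1 by (simp add: l_def)
  have k: "real k \<le> s / l" "s / l \<le> real k + 1"
    using l assms(2) unfolding k_def by (auto simp: floor_divide_lower; linarith)+
  have r': "0 < r'" using assms by (simp add: r'_def)
  have "(2 * \<kappa>) ^ k = 2 powr (l * real k)"
    using ge1 by (simp add: l_def powr_realpow flip: powr_powr)
  also have "\<dots> \<le> 2 powr s" using k(1) l by (simp add: field_simps)
  finally have "(2 * \<kappa>) ^ k * r' \<le> 2 powr s * r'" using r' by simp
  also have "2 powr s * r' = r" by (simp add: r'_def powr_minus field_simps)
  finally have le: "(2 * \<kappa>) ^ k * r' \<le> r" .
  \<comment> \<open>The enlarged ball around \<open>y\<close> still contains the common point
    \<open>z\<close>.\<close>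
  have "1 * r' \<le> (2 * \<kappa>) ^ k * r'" using ge1 r' by (intro mult_right_mono one_le_power) auto
  then have "\<rho> y z < (2 * \<kappa>) ^ k * r'" using assms(4) by (simp add: r'_def)
  moreover have "0 < (2 * \<kappa>) ^ k * r'" using r' ge1 by simp
  ultimately have "enorm (M x r) v \<le> compare_const * enorm (M y ((2 * \<kappa>) ^ k * r')) v"
    using le assms(3) by (intro enorm_compare)
  also have "\<dots> \<le> compare_const * (Q / (1 + \<delta>) ^ k * enorm (M y r') v)"
    using compare_const_ge1 r' by (intro mult_left_mono enorm_decay) auto
  also have "\<dots> = compare_const * Q * (1 / (1 + \<delta>) ^ k) * enorm (M y r') v" by simp
  also have "\<dots> \<le> compare_const * Q * ((1 + \<delta>) * 2 powr (- decay_rate * s)) * enorm (M y r') v"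
  proof (intro mult_right_mono mult_left_mono)
    have "2 powr (decay_rate * s) = (2 powr log 2 (1 + \<delta>)) powr (s / l)"
      by (simp add: decay_rate_def l_def powr_powr)
    also have "\<dots> = (1 + \<delta>) powr (s / l)" using \<delta>_pos by simp
    also have "\<dots> \<le> (1 + \<delta>) powr (real (Suc k))" using k(2) \<delta>_pos by (intro powr_mono) auto
    also have "\<dots> = (1 + \<delta>) * (1 + \<delta>) ^ k" using \<delta>_pos by (subst powr_realpow) auto
    finally show "1 / (1 + \<delta>) ^ k \<le> (1 + \<delta>) * 2 powr (- decay_rate * s)"
      using \<delta>_pos by (simp add: powr_minus field_simps)
  qed (use compare_const_ge1 ge1 in auto)
  finally show ?thesis by (simp add: r'_def mult_ac)
qed

text \<open>Reverses \<open>enorm_compare\<close> by volume. The ratio of the radii is exactly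
  \<open>2 powr s\<close>, so the exponent in this half of the shape condition is 1.\<close>

lemma shape_ge:
  assumes "0 < r" "0 \<le> s" "\<rho> x z < r" "\<rho> y z < r * 2 powr (- s)"
  shows "enorm (M y (r * 2 powr (- s))) v \<le> (compare_const + 3) ^ CARD('n) * V\<^sup>2 * 2 powr s * enorm (M x r) v"
proof -
  define r' where "r' = r * 2 powr (- s)"
  have "2 powr (- s) \<le> 2 powr (0::real)" using assms(2) by (intro powr_mono) auto
  then have r': "0 < r'" "r' \<le> r" using assms(1) by (simp_all add: r'_def)
  have "enorm (M y r') v \<le> (compare_const + 3) ^ CARD('n) * V\<^sup>2 * (r / r') * enorm (M x r) v"
    using r' assms compare_const_ge1 by (intro enorm_reverse enorm_compare[of _ _ _ z]) (auto simp: r'_def)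
  also have "r / r' = 2 powr s" using assms(1) by (simp add: r'_def powr_minus field_simps)
  finally show ?thesis by (simp add: r'_def)
qed

lemma continuous_cover: "continuous_ellipsoid_cover (\<lambda>x t. ellipsoid (M x (2 powr (- t))) x)"
proof -
  define N where "N = (\<lambda>x t. M x (2 powr (- t)))"
  define b where "b = (compare_const + 3) ^ CARD('n) * V\<^sup>2"
  have b: "0 < b" using compare_const_ge1 ge1 by (simp add: b_def)
  have invN: "invertible (N x t)" for x t by (simp add: N_def inv)
  have vol: "1 / V * 2 powr (- t) \<le> measure lebesgue (ellipsoid (N x t) x)"
      "measure lebesgue (ellipsoid (N x t) x) \<le> V * 2 powr (- t)" for x t
    using vol_ge[of "2 powr (- t)" x] vol_le[of "2 powr (- t)" x] by (simp_all add: N_def)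
  have shape: "1 / b * 2 powr (- 1 * s) \<le> 1 / mat_norm (matrix_inv (N y (t + s)) ** N x t) \<and>
      1 / mat_norm (matrix_inv (N y (t + s)) ** N x t) \<le> mat_norm (matrix_inv (N x t) ** N y (t + s)) \<and>
      mat_norm (matrix_inv (N x t) ** N y (t + s)) \<le> compare_const * Q * (1 + \<delta>) * 2 powr (- decay_rate * s)"
    if s: "0 \<le> s" and meet: "ellipsoid (N x t) x \<inter> ellipsoid (N y (t + s)) y \<noteq> {}" for x y t s
  proof -
    have pw: "2 powr (- (t + s)) = 2 powr (- t) * 2 powr (- s)"
      by (simp add: powr_diff powr_minus divide_inverse)
    from meet obtain z where "z \<in> ellipsoid (N x t) x" "z \<in> ellipsoid (N y (t + s)) y" by blast
    then have z: "\<rho> x z < 2 powr (- t)" "\<rho> y z < 2 powr (- t) * 2 powr (- s)"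
      unfolding N_def pw[symmetric] by (auto intro!: ellipsoid_subset_qball)
    have pos: "0 < mat_norm (matrix_inv (N y (t + s)) ** N x t)" by (intro mat_norm_pos invN)
    have "mat_norm (matrix_inv (N y (t + s)) ** N x t) \<le> b * 2 powr s"
      unfolding mat_norm_le_iff[OF invN invN] unfolding N_def pw b_def
      using s z by (intro allI shape_ge) auto
    then have "1 / b * 2 powr (- 1 * s) \<le> 1 / mat_norm (matrix_inv (N y (t + s)) ** N x t)"
      using pos b by (simp add: powr_minus field_simps)
    moreover have "1 / mat_norm (matrix_inv (N y (t + s)) ** N x t)
        \<le> mat_norm (matrix_inv (N x t) ** N y (t + s))"
      using one_le_mat_norm_mult[OF invN invN, of x t y "t + s"] pos by (simp add: field_simps)
    moreover have "mat_norm (matrix_inv (N x t) ** N y (t + s)) \<le> compare_const * Q * (1 + \<delta>) * 2 powr (- decay_rate * s)"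
      unfolding mat_norm_le_iff[OF invN invN] unfolding N_def pw
      using s z by (intro allI shape_le) auto
    ultimately show ?thesis by blast
  qed
  show ?thesis
    unfolding continuous_ellipsoid_cover_def
  \<comment> \<open>The matrices are \<open>N\<close>; the six constants are \<open>1 / V\<close>,
    \<open>V\<close>, \<open>1 / b\<close>, 1, \<open>compare_const * Q * (1 + \<delta>)\<close> and
    \<open>decay_rate\<close>.\<close>
  proof (intro exI conjI allI impI)
    show "invertible (N x t)" for x t by (rule invN)
    show "ellipsoid (M x (2 powr (- t))) x = ellipsoid (N x t) x" for x t by (simp add: N_def)
    show "0 < 1 / V" "0 < V" using ge1 by simp_all
    show "1 / V * 2 powr (- t) \<le> measure lebesgue (ellipsoid (M x (2 powr (- t))) x)"
      "measure lebesgue (ellipsoid (M x (2 powr (- t))) x) \<le> V * 2 powr (- t)" for x t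
      using vol[where x=x and t=t] by (simp_all add: N_def)
    show "0 < 1 / b" "(0::real) < 1" using b by simp_all
    show "0 < compare_const * Q * (1 + \<delta>)" using compare_const_ge1 ge1 \<delta>_pos by simp
    show "0 < decay_rate" by (rule decay_rate_pos)
    fix x y t s assume "0 \<le> (s::real)"
      "ellipsoid (M x (2 powr (- t))) x \<inter> ellipsoid (M y (2 powr (- (t + s)))) y \<noteq> {}"
    then show "1 / b * 2 powr (- 1 * s) \<le> 1 / mat_norm (matrix_inv (N y (t + s)) ** N x t)"
      "1 / mat_norm (matrix_inv (N y (t + s)) ** N x t) \<le> mat_norm (matrix_inv (N x t) ** N y (t + s))"
      "mat_norm (matrix_inv (N x t) ** N y (t + s)) \<le> compare_const * Q * (1 + \<delta>) * 2 powr (- decay_rate * s)"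
      using shape[where s=s and x=x and t=t and y=y] by (simp_all add: N_def)
  qed
qed

section \<open>Equivalence of the induced quasi-distance with the given one\<close>

abbreviation \<rho>' where "\<rho>' \<equiv> induced_qdist {ellipsoid (M x r) x |x r. 0 < r}"

text \<open>Above, an ellipsoid of radius enlarged by \<open>D\<close> swallows the whole ball, and
  its volume is controlled by that radius. Below, two points of an ellipsoid of radius
  \<open>r\<close> have distance at most \<open>2 * \<kappa> * r\<close>, while its volume is at
  least \<open>r / V\<close>.\<close>

lemma induced_equivalent: "equivalent_qdist \<rho> \<rho>'"
proof -
  \<comment> \<open>One factor \<open>Q\<close> comes from \<open>outer\<close>, the other from
    \<open>enorm_decay\<close>; \<open>k\<close> enlargements suffice to absorb both.\<close>
  obtain k where k: "Q\<^sup>2 \<le> (1 + \<delta>) ^ k"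
    using real_arch_pow[of "1 + \<delta>" "Q\<^sup>2"] \<delta>_pos by (auto intro: less_imp_le)
  define D where "D = (2 * \<kappa>) ^ k"
  have D: "1 \<le> D" unfolding D_def using ge1 by (intro one_le_power) auto
  have cover: "y \<in> ellipsoid (M x (D * r)) x" if "\<rho> x y < r" for x y r
  proof -
    have r: "0 < r" using \<rho>_nonneg that by (rule le_less_trans)
    have "enorm (M x (D * r)) (y - x) \<le> Q / (1 + \<delta>) ^ k * enorm (M x r) (y - x)"
      unfolding D_def using r by (rule enorm_decay)
    also have "\<dots> \<le> Q / (1 + \<delta>) ^ k * Q"
      using that r ge1 \<delta>_pos by (intro mult_left_mono outer) auto
    also have "\<dots> \<le> 1" using k \<delta>_pos by (simp add: field_simps power2_eq_square)
    finally show ?thesis using r D by (simp add: mem)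
  qed
  have center: "x \<in> ellipsoid (M x r) x" if "0 < r" for x r using that by (simp add: mem)
  have upper: "\<rho>' x y \<le> V * D * \<rho> x y" for x y
  proof (rule field_le_epsilon)
    fix e :: real assume e: "0 < e"
    \<comment> \<open>The slack makes the radius strictly larger than the distance, hence positive
      even for \<open>x = y\<close>; it contributes exactly \<open>e\<close> after multiplication by
      \<open>V * D\<close>.\<close>
    define r where "r = \<rho> x y + e / (V * D)"
    have r: "\<rho> x y < r" using e ge1 D by (simp add: r_def)
    have pos: "0 < D * r" using le_less_trans[OF \<rho>_nonneg r] D by simp
    have "\<rho>' x y \<le> measure lebesgue (ellipsoid (M x (D * r)) x)"
      unfolding induced_qdist_def using cover[OF r] center[OF pos] pos
      by (intro cInf_lower) (auto intro!: bdd_belowI[of _ 0])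
    also have "\<dots> \<le> V * (D * r)" using pos by (rule vol_le)
    also have "\<dots> = V * D * \<rho> x y + e" using ge1 D by (simp add: r_def field_simps)
    finally show "\<rho>' x y \<le> V * D * \<rho> x y + e" .
  qed
  have lower: "\<rho> x y / (2 * \<kappa> * V) \<le> \<rho>' x y" for x y
    unfolding induced_qdist_def
  proof (rule cInf_greatest)
    define r where "r = D * (\<rho> x y + 1)"
    have "0 < r" using \<rho>_nonneg[of x y] D by (simp add: r_def)
    moreover from this have "x \<in> ellipsoid (M x r) x" by (rule center)
    moreover have "y \<in> ellipsoid (M x r) x" unfolding r_def by (rule cover) simp
    ultimately show "{measure lebesgue E |E. E \<in> {ellipsoid (M x r) x |x r. 0 < r} \<and> x \<in> E \<and> y \<in> E} \<noteq> {}"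
      by blast
    fix m assume "m \<in> {measure lebesgue E |E. E \<in> {ellipsoid (M x r) x |x r. 0 < r} \<and> x \<in> E \<and> y \<in> E}"
    then obtain z r where z: "0 < r" "x \<in> ellipsoid (M z r) z" "y \<in> ellipsoid (M z r) z"
      and m: "m = measure lebesgue (ellipsoid (M z r) z)" by blast
    then have "\<rho> x z < r" "\<rho> z y < r"
      using ellipsoid_subset_qball by (auto simp: \<rho>_commute[of x z])
    from \<rho>_triangle_less[OF this] have "\<rho> x y \<le> 2 * \<kappa> * r" by simp
    also have "r \<le> V * m" using vol_ge[OF z(1), of z] ge1 by (simp add: m field_simps)
    finally show "\<rho> x y / (2 * \<kappa> * V) \<le> m" using ge1 by (simp add: field_simps)
  qed
  define C where "C = max (V * D) (2 * \<kappa> * V)"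
  have "1 * 1 \<le> V * D" using ge1 D by (intro mult_mono) auto
  then have C: "1 \<le> C" "V * D \<le> C" "2 * \<kappa> * V \<le> C" by (auto simp: C_def)
  show ?thesis
    unfolding equivalent_qdist_def
  proof (intro exI[of _ C] conjI allI C(1))
    fix x y
    have "inverse C * \<rho> x y \<le> inverse (2 * \<kappa> * V) * \<rho> x y"
      using C ge1 \<rho>_nonneg by (intro mult_right_mono le_imp_inverse_le) auto
    also have "\<dots> \<le> \<rho>' x y" using lower[of x y] by (simp add: field_simps)
    finally show "inverse C * \<rho> x y \<le> \<rho>' x y" .
    show "\<rho>' x y \<le> C * \<rho> x y"
      using upper[of x y] mult_right_mono[OF C(2) \<rho>_nonneg[of x y]] by linarith
  qed
qed

end

section \<open>Passage from a given quasi-distance to the locale, and the theorem\<close>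

lemma corresponding_ellipsoids_imp_locale:
  fixes \<rho> :: "real^'n \<Rightarrow> real^'n \<Rightarrow> real"
  assumes "quasi_distance \<rho>" "ahlfors_regular_1 \<rho>" "corresponding_ellipsoids \<rho> \<xi>"
  obtains M \<kappa> Q V where "regular_ellipsoids \<rho> M \<kappa> Q V"
    "\<And>x r. 0 < r \<Longrightarrow> \<xi> x r = ellipsoid (M x r) x"
proof -
  obtain \<kappa> where nonneg: "\<And>x y. 0 \<le> \<rho> x y" and \<kappa>: "1 \<le> \<kappa>"
    and qd: "\<And>x y z. (\<rho> x y = 0 \<longleftrightarrow> x = y) \<and> \<rho> x y = \<rho> y x \<and> \<rho> x z \<le> \<kappa> * (\<rho> x y + \<rho> y z)"
    using assms(1) unfolding quasi_distance_def by metis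
  obtain c where c: "1 \<le> c" and vol: "\<And>x r. 0 < r \<Longrightarrow> qball \<rho> x r \<in> lmeasurable \<and>
      1 / c * r \<le> measure lebesgue (qball \<rho> x r) \<and> measure lebesgue (qball \<rho> x r) \<le> c * r"
    using assms(2) unfolding ahlfors_regular_1_def by metis
  obtain Q where Q: "1 \<le> Q" and ex: "\<forall>x. \<forall>r>0. \<exists>M. invertible M \<and> \<xi> x r = ellipsoid M x \<and>
      \<xi> x r \<subseteq> qball \<rho> x r \<and> qball \<rho> x r \<subseteq> ellipsoid (Q *\<^sub>R M) x"
    using assms(3) unfolding corresponding_ellipsoids_def by metis
  obtain M where M: "\<And>x r. 0 < r \<Longrightarrow> invertible (M x r) \<and> \<xi> x r = ellipsoid (M x r) x \<and>
      \<xi> x r \<subseteq> qball \<rho> x r \<and> qball \<rho> x r \<subseteq> ellipsoid (Q *\<^sub>R M x r) x"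
    using ex by metis
  \<comment> \<open>A ball lies in the dilation by \<open>Q\<close> of its ellipsoid, so the lower
    volume bound loses \<open>Q ^ CARD('n)\<close> in passing from the ball to the
    ellipsoid.\<close>
  define V where "V = c * Q ^ CARD('n)"
  have "1 \<le> Q ^ CARD('n)" using Q by simp
  then have V: "1 \<le> V" "c \<le> V"
    using c mult_mono[of 1 c 1 "Q ^ CARD('n)"] mult_left_mono[of 1 "Q ^ CARD('n)" c]
    by (simp_all add: V_def)
  have "regular_ellipsoids \<rho> M \<kappa> Q V"
  proof
    fix x y :: "real^'n" and r :: real assume r: "0 < r"
    have inv: "invertible (M x r)" and eq: "\<xi> x r = ellipsoid (M x r) x"
      using M[OF r, of x] by blast+
    have sub: "ellipsoid (M x r) x \<subseteq> qball \<rho> x r" "qball \<rho> x r \<subseteq> ellipsoid (Q *\<^sub>R M x r) x"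
      using M[OF r, of x] unfolding eq by blast+
    show "invertible (M x r)" by (rule inv)
    show "\<rho> x y < r" if "enorm (M x r) (y - x) \<le> 1"
      using sub(1) that inv by (auto simp: mem_ellipsoid qball_def)
    show "enorm (M x r) (y - x) \<le> Q" if "\<rho> x y < r"
    proof -
      have "y \<in> ellipsoid (Q *\<^sub>R M x r) x" using sub(2) that by (auto simp: qball_def)
      then show ?thesis using inv Q by (simp add: mem_ellipsoid_scaleR)
    qed
    have "measure lebesgue (ellipsoid (M x r) x) \<le> measure lebesgue (qball \<rho> x r)"
      using vol[OF r] by (intro measure_mono_fmeasurable sub fmeasurableD ellipsoid_lmeasurable) auto
    also have "\<dots> \<le> c * r" using vol[OF r] by blast
    also have "\<dots> \<le> V * r" using V(2) r by simp
    finally show "measure lebesgue (ellipsoid (M x r) x) \<le> V * r" .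
    have "1 / c * r \<le> measure lebesgue (qball \<rho> x r)" using vol[OF r] by blast
    also have "\<dots> \<le> measure lebesgue (ellipsoid (Q *\<^sub>R M x r) x)"
      using vol[OF r] by (intro measure_mono_fmeasurable sub ellipsoid_lmeasurable fmeasurableD) auto
    also have "\<dots> = Q ^ CARD('n) * measure lebesgue (ellipsoid (M x r) x)"
      using Q by (simp add: measure_ellipsoid_scaleR)
    finally show "r / V \<le> measure lebesgue (ellipsoid (M x r) x)"
      using c Q by (simp add: V_def field_simps)
  qed (use \<kappa> Q V nonneg qd in blast)+
  then show ?thesis using M that by blast
qed

theorem theorem4p9:
  shows
    "(\<forall>\<theta> :: real^'n \<Rightarrow> real \<Rightarrow> (real^'n) set.
        continuous_ellipsoid_cover \<theta> \<longrightarrow>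
          quasi_distance (induced_qdist {\<theta> x t |x t. True}) \<and>
          quasi_convex (induced_qdist {\<theta> x t |x t. True}) \<and>
          ahlfors_regular_1 (induced_qdist {\<theta> x t |x t. True})) \<and>
     (\<forall>(\<rho> :: real^'n \<Rightarrow> real^'n \<Rightarrow> real) (\<xi> :: real^'n \<Rightarrow> real \<Rightarrow> (real^'n) set).
        quasi_distance \<rho> \<longrightarrow> quasi_convex \<rho> \<longrightarrow> ahlfors_regular_1 \<rho> \<longrightarrow>
        corresponding_ellipsoids \<rho> \<xi> \<longrightarrow>
          continuous_ellipsoid_cover (\<lambda>x t. \<xi> x (2 powr (- t))) \<and>
          quasi_distance (induced_qdist {\<xi> x r |x r. r > 0}) \<and>
          equivalent_qdist \<rho> (induced_qdist {\<xi> x r |x r. r > 0}))"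
proof (rule conjI; (intro allI impI))
  fix \<theta> :: "real^'n \<Rightarrow> real \<Rightarrow> (real^'n) set"
  assume "continuous_ellipsoid_cover \<theta>"
  then show "quasi_distance (induced_qdist {\<theta> x t |x t. True}) \<and>
      quasi_convex (induced_qdist {\<theta> x t |x t. True}) \<and>
      ahlfors_regular_1 (induced_qdist {\<theta> x t |x t. True})"
    by (rule continuous_ellipsoid_cover_imp_qdist)
next
  fix \<rho> :: "real^'n \<Rightarrow> real^'n \<Rightarrow> real" and \<xi> :: "real^'n \<Rightarrow> real \<Rightarrow> (real^'n) set"
  assume "quasi_distance \<rho>" "ahlfors_regular_1 \<rho>" "corresponding_ellipsoids \<rho> \<xi>"
  then obtain M \<kappa> Q V where loc: "regular_ellipsoids \<rho> M \<kappa> Q V"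
    and eq: "\<And>x r. 0 < r \<Longrightarrow> \<xi> x r = ellipsoid (M x r) x"
    using corresponding_ellipsoids_imp_locale by blast
  interpret regular_ellipsoids \<rho> M \<kappa> Q V by (rule loc)
  have "(\<lambda>x t. \<xi> x (2 powr (- t))) = (\<lambda>x t. ellipsoid (M x (2 powr (- t))) x)"
    by (simp add: eq)
  then have cover: "continuous_ellipsoid_cover (\<lambda>x t. \<xi> x (2 powr (- t)))"
    using continuous_cover by simp
  \<comment> \<open>Every positive radius is a power \<open>2 powr (- t)\<close>, so both families
    consist of the same sets, and the first half of the theorem applied to the new cover shows that
    its induced function is a quasi-distance.\<close>
  have reindex: "{\<xi> x r |x r. r > 0} = {\<xi> x (2 powr (- t)) |x t. True}"
  proof (intro equalityI subsetI)
    fix E assume "E \<in> {\<xi> x r |x r. r > 0}"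
    then obtain x r where "0 < r" "E = \<xi> x r" by blast
    then have "E = \<xi> x (2 powr (- (- log 2 r)))" by simp
    then show "E \<in> {\<xi> x (2 powr (- t)) |x t. True}" by blast
  next
    fix E assume "E \<in> {\<xi> x (2 powr (- t)) |x t. True}"
    then obtain x t where "E = \<xi> x (2 powr (- t))" by blast
    moreover have "0 < (2::real) powr (- t)" by simp
    ultimately show "E \<in> {\<xi> x r |x r. r > 0}" by blast
  qed
  have "{\<xi> x r |x r. r > 0} = {ellipsoid (M x r) x |x r. 0 < r}"
    using eq by (auto; metis)
  then show "continuous_ellipsoid_cover (\<lambda>x t. \<xi> x (2 powr (- t))) \<and>
      quasi_distance (induced_qdist {\<xi> x r |x r. r > 0}) \<and>
      equivalent_qdist \<rho> (induced_qdist {\<xi> x r |x r. r > 0})"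
    using cover continuous_ellipsoid_cover_imp_qdist[OF cover] induced_equivalent
    by (simp add: reindex)
qed

end
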